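(* Let $(\mathcal V,\mathcal E)$ be a connected, acyclic, undirected graph on $n$ nodes with edge weights $b_{ij}>0$, and let $E\in\mathbb{R}^{n\times(n-1)}$ be its (weighted) incidence matrix, so that $L=EE^{\top}$ is the weighted graph Laplacian. Let $E_{\rm c}\in\mathbb{R}^{n\times(n-1)}$ be the (weighted) incidence matrix of a connected, acyclic, undirected communication graph on the same nodes, with $E_{\rm c}E_{\rm c}^{\top}=\gamma EE^{\top}$ for some $\gamma>0$. Let $m,d,k,b,\tau,\tau_\nu>0$ and put $M=mI_n$, $D=dI_n$, $K=kI_n$, $B_1=bI_n$, $\mathcal T_\mu=\tau I_n$, $\mathcal T_\nu=\tau_\nu I_{n-1}$. For $\alpha\ge 0$ let $G(\alpha)$ be the linear system with state $(\varphi,\omega,\mu,\nu)\in\mathbb{R}^{n-1}\times\mathbb{R}^n\times\mathbb{R}^n\times\mathbb{R}^{n-1}$, input $\eta\in\mathbb{R}^n$ and output $y\in\mathbb{R}^n$: $$\dot\varphi=E^\top\omega,\qquad M\dot\omega=-E\varphi-D\omega-K^{-1}\mu+B_1\eta,$$ $$\mathcal T_\mu\dot\mu=\alpha K^{-1}\omega-K^{-1}\mu-E_{\rm c}\nu+B_1\eta,\qquad \mathcal T_\nu\dot\nu=E_{\rm c}^\top\mu,\qquad y=-K^{-1/2}\mu .$$ Then for every $\alpha\ge0$, $$\|G(\alpha)\|_{\mathcal H_2}^2\le\frac{b^2}{2\tau}\,n+\frac{b^2\alpha n}{2m}.$$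
   Context: The weighted incidence matrix of a weighted graph has one column per edge; after fixing an arbitrary orientation, the column of edge $\{i,j\}$ with weight $w_{ij}$ is $\sqrt{w_{ij}}\,(e_i-e_j)$, where $e_i$ are the standard basis vectors, so that (incidence)(incidence)$^\top$ is the weighted Laplacian. $\mathcal H_2$ norm: for an input-output stable linear system $\dot x=Ax+B\eta$, $y=Cx$, $\|G\|_{\mathcal H_2}^2=\lim_{t\to\infty}\mathbb E[y(t)^\top y(t)]$ when $\eta$ is white noise with $\mathbb E[\eta(t)\eta(\tau)^\top]=\delta(t-\tau)I$; equivalently $\|G\|_{\mathcal H_2}^2=\int_0^\infty \mathrm{Tr}\big(B^\top e^{A^\top t}C^\top C e^{At}B\big)\,dt$. When $A$ is Hurwitz this equals $\mathrm{Tr}(B^\top XB)$ with $X$ the observability Gramian, $XA+A^\top X+C^\top C=0$. Interpretation: the system is the linearized swing dynamics of a power network ($\varphi=E^\top\theta$, $\theta$ the phase angles, $\omega$ the frequency deviations) with control $p=-K^{-1}\mu$ generated by a primal-dual algorithm with multipliers $\nu$ and frequency feedback gain $\alpha$; $\|y\|_2^2=p^\top Kp$. *)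

theory Defs
  imports "HOL-Analysis.Analysis" "Jordan_Normal_Form.Matrix"
begin

text \<open>
  Matrices are those of Jordan-Normal-Form, whose dimensions are natural numbers. This allows
  n * (n - 1) incidence matrices for every n, including n = 1 (no edges, empty edge state).
  Since HOL-Analysis has constants of the same names, some names are qualified.
\<close>

section \<open>Undirected graphs on the nodes 0, ..., n - 1\<close>

definition simple_graph :: "nat \<Rightarrow> nat set set \<Rightarrow> bool" where
  "simple_graph n F \<longleftrightarrow> F \<subseteq> {{i, j} | i j. i < n \<and> j < n \<and> i \<noteq> j}"

definition connected_graph :: "nat \<Rightarrow> nat set set \<Rightarrow> bool" where
  "connected_graph n F \<longleftrightarrow>
     0 < n \<and> (\<forall>i<n. \<forall>j<n. (i, j) \<in> {(u, v). {u, v} \<in> F}\<^sup>*)"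

definition graph_cycle :: "nat set set \<Rightarrow> nat list \<Rightarrow> bool" where
  "graph_cycle F xs \<longleftrightarrow> 3 \<le> length xs \<and> distinct xs \<and>
     (\<forall>i<length xs. {xs ! i, xs ! (Suc i mod length xs)} \<in> F)"

definition acyclic_graph :: "nat set set \<Rightarrow> bool" where
  "acyclic_graph F \<longleftrightarrow> (\<nexists>xs. graph_cycle F xs)"

text \<open>
  The columns of an incidence matrix are in bijection with the edges (the enumeration \<open>e\<close> is
  arbitrary), and each edge may be oriented either way: \<open>{i, j} = {j, i}\<close>, so the
  existential picks the orientation separately for each column.
\<close>

definition weighted_incidence ::
  "nat \<Rightarrow> nat set set \<Rightarrow> (nat set \<Rightarrow> real) \<Rightarrow> real mat \<Rightarrow> bool" where
  "weighted_incidence n F w E \<longleftrightarrow> dim_row E = n \<and>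
     (\<exists>e. bij_betw e {..<dim_col E} F \<and>
       (\<forall>l<dim_col E. \<exists>i<n. \<exists>j<n. i \<noteq> j \<and> e l = {i, j} \<and>
          col E l = sqrt (w {i, j}) \<cdot>\<^sub>v (unit_vec n i - unit_vec n j)))"

section \<open>The H2 norm of a linear system\<close>

text \<open>The entrywise limit of the exponential series (it converges for every square matrix).\<close>

definition mat_exp :: "real mat \<Rightarrow> real mat" where
  "mat_exp A = Matrix.mat (dim_row A) (dim_row A) (\<lambda>ij. \<Sum>l. (A ^\<^sub>m l) $$ ij / fact l)"

definition mat_trace :: "real mat \<Rightarrow> real" where
  "mat_trace A = (\<Sum>i<dim_row A. A $$ (i, i))"

text \<open>
  The squared H2 norm of \<open>x' = A x + B \<eta>, y = C x\<close>. The integrand is the squared Frobenius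
  norm of the impulse response \<open>C exp(t A) B\<close>, hence nonnegative, and so the integral always
  exists in the extended nonnegative reals; it is \<open>\<infinity>\<close> if the system is not input-output stable.
\<close>

definition h2_norm_sq :: "real mat \<Rightarrow> real mat \<Rightarrow> real mat \<Rightarrow> ennreal" where
  "h2_norm_sq A B C = (\<integral>\<^sup>+ t. ennreal (mat_trace
       (transpose_mat B * mat_exp (t \<cdot>\<^sub>m transpose_mat A) * transpose_mat C *
        C * mat_exp (t \<cdot>\<^sub>m A) * B)) * indicator {0..} t \<partial>lborel)"

section \<open>The closed-loop system\<close>

text \<open>
  The state is \<open>(\<phi> @\<^sub>v \<omega>) @\<^sub>v (\<mu> @\<^sub>v \<nu>)\<close>, and the equations are solved for the derivatives;
  \<open>p\<close> is the number n - 1 of columns of \<open>E\<close> and \<open>Ec\<close>, and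
  \<open>M = m I\<close>, \<open>D = d I\<close>, \<open>K = k I\<close>, \<open>B\<^sub>1 = b I\<close>, \<open>T\<^sub>\<mu> = \<tau> I\<close>, \<open>T\<^sub>\<nu> = \<tau>\<nu> I\<close>.
\<close>

definition sys_A ::
  "nat \<Rightarrow> nat \<Rightarrow> real mat \<Rightarrow> real mat \<Rightarrow> real \<Rightarrow> real \<Rightarrow> real \<Rightarrow> real \<Rightarrow> real \<Rightarrow> real \<Rightarrow> real mat"
where
  "sys_A n p E Ec m d k \<tau> \<tau>\<nu> \<alpha> = four_block_mat
     (four_block_mat
        (0\<^sub>m p p)             (transpose_mat E)
        ((- 1 / m) \<cdot>\<^sub>m E)    ((- d / m) \<cdot>\<^sub>m 1\<^sub>m n))
     (four_block_mat
        (0\<^sub>m p n)                     (0\<^sub>m p p)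
        ((- 1 / (m * k)) \<cdot>\<^sub>m 1\<^sub>m n)   (0\<^sub>m n p))
     (four_block_mat
        (0\<^sub>m n p)   ((\<alpha> / (\<tau> * k)) \<cdot>\<^sub>m 1\<^sub>m n)
        (0\<^sub>m p p)   (0\<^sub>m p n))
     (four_block_mat
        ((- 1 / (\<tau> * k)) \<cdot>\<^sub>m 1\<^sub>m n)          ((- 1 / \<tau>) \<cdot>\<^sub>m Ec)
        ((1 / \<tau>\<nu>) \<cdot>\<^sub>m transpose_mat Ec)   (0\<^sub>m p p))"

definition sys_B :: "nat \<Rightarrow> nat \<Rightarrow> real \<Rightarrow> real \<Rightarrow> real \<Rightarrow> real mat" where
  "sys_B n p m b \<tau> =
     (0\<^sub>m p n @\<^sub>r ((b / m) \<cdot>\<^sub>m 1\<^sub>m n)) @\<^sub>r (((b / \<tau>) \<cdot>\<^sub>m 1\<^sub>m n) @\<^sub>r 0\<^sub>m p n)"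

definition sys_C :: "nat \<Rightarrow> nat \<Rightarrow> real \<Rightarrow> real mat" where
  "sys_C n p k = transpose_mat
     ((0\<^sub>m p n @\<^sub>r 0\<^sub>m n n) @\<^sub>r (((- 1 / sqrt k) \<cdot>\<^sub>m 1\<^sub>m n) @\<^sub>r 0\<^sub>m p n))"

lemma four_block_mult_vec4:
  fixes P1 :: "real mat"
  assumes "P1 \<in> carrier_mat p p" "Q1 \<in> carrier_mat p n" "R1 \<in> carrier_mat n p" "S1 \<in> carrier_mat n n"
    "P2 \<in> carrier_mat p n" "Q2 \<in> carrier_mat p p" "R2 \<in> carrier_mat n n" "S2 \<in> carrier_mat n p"
    "P3 \<in> carrier_mat n p" "Q3 \<in> carrier_mat n n" "R3 \<in> carrier_mat p p" "S3 \<in> carrier_mat p n"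
    "P4 \<in> carrier_mat n n" "Q4 \<in> carrier_mat n p" "R4 \<in> carrier_mat p n" "S4 \<in> carrier_mat p p"
    "\<phi> \<in> carrier_vec p" "\<omega> \<in> carrier_vec n" "\<mu> \<in> carrier_vec n" "\<nu> \<in> carrier_vec p"
  shows "four_block_mat (four_block_mat P1 Q1 R1 S1) (four_block_mat P2 Q2 R2 S2)
      (four_block_mat P3 Q3 R3 S3) (four_block_mat P4 Q4 R4 S4) *\<^sub>v ((\<phi> @\<^sub>v \<omega>) @\<^sub>v (\<mu> @\<^sub>v \<nu>)) =
    (((P1 *\<^sub>v \<phi> + Q1 *\<^sub>v \<omega>) @\<^sub>v (R1 *\<^sub>v \<phi> + S1 *\<^sub>v \<omega>)) +
     ((P2 *\<^sub>v \<mu> + Q2 *\<^sub>v \<nu>) @\<^sub>v (R2 *\<^sub>v \<mu> + S2 *\<^sub>v \<nu>))) @\<^sub>v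
    (((P3 *\<^sub>v \<phi> + Q3 *\<^sub>v \<omega>) @\<^sub>v (R3 *\<^sub>v \<phi> + S3 *\<^sub>v \<omega>)) +
     ((P4 *\<^sub>v \<mu> + Q4 *\<^sub>v \<nu>) @\<^sub>v (R4 *\<^sub>v \<mu> + S4 *\<^sub>v \<nu>)))"
  by (subst four_block_mat_mult_vec[where ?nr1.0 = "p + n" and ?nr2.0 = "n + p"
        and ?nc1.0 = "p + n" and ?nc2.0 = "n + p"],
      (use assms in \<open>simp_all add: append_carrier_vec\<close>)[6],
      simp only: four_block_mat_mult_vec[OF assms(1-4) assms(17,18)]
        four_block_mat_mult_vec[OF assms(5-8) assms(19,20)]
        four_block_mat_mult_vec[OF assms(9-12) assms(17,18)]
        four_block_mat_mult_vec[OF assms(13-16) assms(19,20)])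

lemma smult_mat_mult_vec:
  "dim_vec x = dim_col M \<Longrightarrow> (c \<cdot>\<^sub>m M) *\<^sub>v x = c \<cdot>\<^sub>v (M *\<^sub>v x)" for c :: real
  by (intro eq_vecI) auto

lemma zero_mat_mult_vec: "dim_vec x = s \<Longrightarrow> 0\<^sub>m r s *\<^sub>v x = 0\<^sub>v r" for x :: "real Matrix.vec"
  by (intro eq_vecI) auto

lemma sys_state_equation:
  assumes E: "E \<in> carrier_mat n p" and Ec: "Ec \<in> carrier_mat n p"
    and v: "\<phi> \<in> carrier_vec p" "\<omega> \<in> carrier_vec n" "\<mu> \<in> carrier_vec n" "\<nu> \<in> carrier_vec p"
      "\<eta> \<in> carrier_vec n"
  shows "sys_A n p E Ec m d k \<tau> \<tau>\<nu> \<alpha> *\<^sub>v ((\<phi> @\<^sub>v \<omega>) @\<^sub>v (\<mu> @\<^sub>v \<nu>)) + sys_B n p m b \<tau> *\<^sub>v \<eta> =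
    (transpose_mat E *\<^sub>v \<omega> @\<^sub>v
     (1 / m) \<cdot>\<^sub>v (- (E *\<^sub>v \<phi>) - d \<cdot>\<^sub>v \<omega> - (1 / k) \<cdot>\<^sub>v \<mu> + b \<cdot>\<^sub>v \<eta>)) @\<^sub>v
    ((1 / \<tau>) \<cdot>\<^sub>v ((\<alpha> / k) \<cdot>\<^sub>v \<omega> - (1 / k) \<cdot>\<^sub>v \<mu> - Ec *\<^sub>v \<nu> + b \<cdot>\<^sub>v \<eta>) @\<^sub>v
     (1 / \<tau>\<nu>) \<cdot>\<^sub>v (transpose_mat Ec *\<^sub>v \<mu>))"
proof -
  note car = E Ec v
  have B: "sys_B n p m b \<tau> *\<^sub>v \<eta> =
     (0\<^sub>v p @\<^sub>v (b / m) \<cdot>\<^sub>v \<eta>) @\<^sub>v ((b / \<tau>) \<cdot>\<^sub>v \<eta> @\<^sub>v 0\<^sub>v p)"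
    unfolding sys_B_def using v
    by (simp add: mat_mult_append[where nc = n and ?nr1.0 = "p + n" and ?nr2.0 = "n + p"]
        mat_mult_append[where nc = n and ?nr1.0 = p and ?nr2.0 = n]
        mat_mult_append[where nc = n and ?nr1.0 = n and ?nr2.0 = p]
        carrier_append_rows zero_mat_mult_vec smult_mat_mult_vec)
  have dims: "dim_row E = n" "dim_col E = p" "dim_row Ec = n" "dim_col Ec = p"
    "dim_vec \<phi> = p" "dim_vec \<omega> = n" "dim_vec \<mu> = n" "dim_vec \<nu> = p" "dim_vec \<eta> = n"
    using car by auto
  show ?thesis
    unfolding B unfolding sys_A_def
    apply (subst four_block_mult_vec4[where p = p and n = n])
    using car apply (simp_all only: carrier_matI dims index_smult_mat index_transpose_mat 
        index_zero_mat index_one_mat smult_carrier_mat transpose_carrier_mat zero_carrier_mat one_carrier_mat)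
    apply (rule eq_vecI)
    using dims by (auto simp: append_vec_def Let_def smult_mat_mult_vec zero_mat_mult_vec
      diff_divide_distrib add_divide_distrib algebra_simps)
qed

lemma sys_output_equation:
  assumes v: "\<phi> \<in> carrier_vec p" "\<omega> \<in> carrier_vec n" "\<mu> \<in> carrier_vec n" "\<nu> \<in> carrier_vec p"
  shows "sys_C n p k *\<^sub>v ((\<phi> @\<^sub>v \<omega>) @\<^sub>v (\<mu> @\<^sub>v \<nu>)) = (- 1 / sqrt k) \<cdot>\<^sub>v \<mu>"
proof -
  have dims: "dim_vec \<phi> = p" "dim_vec \<omega> = n" "dim_vec \<mu> = n" "dim_vec \<nu> = p"
    using v by auto
  let ?C = "sys_C n p k" and ?x = "(\<phi> @\<^sub>v \<omega>) @\<^sub>v (\<mu> @\<^sub>v \<nu>)"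
  have d: "dim_row ?C = n" "dim_col ?C = p + n + (n + p)"
    by (auto simp: sys_C_def append_rows_def)
  have C: "?C $$ (i, j) = (if j = p + n + i then - 1 / sqrt k else 0)"
    if "i < n" "j < p + n + (n + p)" for i j
    using that by (auto simp: sys_C_def append_rows_def)
  show ?thesis
  proof (rule eq_vecI)
    fix i assume "i < dim_vec ((- 1 / sqrt k) \<cdot>\<^sub>v \<mu>)"
    then have i: "i < n" using dims by simp
    have "vec_index (?C *\<^sub>v ?x) i = (\<Sum>j\<in>{0..<p + n + (n + p)}. ?C $$ (i, j) * vec_index ?x j)"
      using i d dims by (simp add: scalar_prod_def)
    also have "\<dots> = (\<Sum>j\<in>{0..<p + n + (n + p)}. if j = p + n + i then (- 1 / sqrt k) * vec_index ?x j else 0)"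
      using i by (intro sum.cong) (auto simp: C)
    also have "\<dots> = (- 1 / sqrt k) * vec_index ?x (p + n + i)"
      using i by (subst sum.delta) auto
    also have "\<dots> = vec_index ((- 1 / sqrt k) \<cdot>\<^sub>v \<mu>) i"
      using i dims by simp
    finally show "vec_index (?C *\<^sub>v ?x) i = vec_index ((- 1 / sqrt k) \<cdot>\<^sub>v \<mu>) i" .
  qed (use d dims in auto)
qed

end

theory Submission
  imports Defs
begin

text \<open>
  The weighted energy
  \<open>V = (\<alpha> |\<phi>|\<^sup>2 + \<alpha> m |\<omega>|\<^sup>2 + \<tau> |\<mu>|\<^sup>2 + \<tau>\<nu> |\<nu>|\<^sup>2) / 2 = x\<^sup>T X x\<close> satisfies
  \<open>V' = - \<alpha> d |\<omega>|\<^sup>2 - |y|\<^sup>2\<close> along the unforced system: \<open>E\<close> cancels against \<open>E\<^sup>T\<close> and \<open>Ec\<close> against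
  \<open>Ec\<^sup>T\<close>, and weighting the physical energy by \<open>\<alpha>\<close> cancels the power exchanged between \<open>\<omega>\<close> and \<open>\<mu>\<close>.
  Integrating over the impulse responses bounds the squared H2 norm by the trace of \<open>B\<^sup>T X B\<close>.
\<close>

section \<open>Matrix powers and the exponential as an entrywise power series in time\<close>

lemma smult_pow_mat:
  fixes A :: "real mat"
  assumes "A \<in> carrier_mat N N"
  shows "(t \<cdot>\<^sub>m A) ^\<^sub>m l = t ^ l \<cdot>\<^sub>m (A ^\<^sub>m l)"
proof (induction l)
  case 0
  then show ?case using assms by auto
next
  case (Suc l)
  have "A ^\<^sub>m l \<in> carrier_mat N N" using assms by (rule pow_carrier_mat)
  then show ?case using assms Suc
    by (auto simp: mult_smult_assoc_mat[of _ N N _ N] mult_smult_distrib[of _ N N _ N])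
qed

text \<open>The recursion defining \<open>^\<^sub>m\<close> puts the new factor on the right.
  Splitting it off on the left is what yields the derivative \<open>A * exp (t A)\<close>, and also
  what reconciles powers with transposition.\<close>

lemma pow_mat_Suc_left:
  fixes A :: "real mat"
  assumes A: "A \<in> carrier_mat N N"
  shows "A ^\<^sub>m Suc l = A * A ^\<^sub>m l"
proof (induction l)
  case 0
  then show ?case using A by auto
next
  case (Suc l)
  have "A ^\<^sub>m Suc (Suc l) = (A * A ^\<^sub>m l) * A" using Suc by simp
  also have "\<dots> = A * A ^\<^sub>m Suc l"
    using assoc_mult_mat[OF A pow_carrier_mat[OF A] A] by simp
  finally show ?case .
qed

lemma transpose_pow_mat:
  fixes A :: "real mat"
  assumes A: "A \<in> carrier_mat N N"
  shows "transpose_mat A ^\<^sub>m l = transpose_mat (A ^\<^sub>m l)"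
proof (induction l)
  case 0
  then show ?case using A by auto
next
  case (Suc l)
  then show ?case
    using transpose_mult[OF A pow_carrier_mat[OF A]] pow_mat_Suc_left[OF A] by simp
qed

lemma pow_mat_Suc_entry:
  fixes A :: "real mat"
  assumes A: "A \<in> carrier_mat N N" and ij: "i < N" "j < N"
  shows "(A ^\<^sub>m Suc l) $$ (i, j) = (\<Sum>r<N. A $$ (i, r) * (A ^\<^sub>m l) $$ (r, j))"
  unfolding pow_mat_Suc_left[OF A] using A ij pow_carrier_mat[OF A, of l]
  by (auto simp: scalar_prod_def atLeast0LessThan intro!: sum.cong)

text \<open>The sum of the absolute values of all entries is a submultiplicative norm that dominates
  every entry. This crude bound suffices to compare the exponential series with a scalar
  one.\<close>

lemma abs_pow_mat_entry_le:
  fixes A :: "real mat"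
  assumes A: "A \<in> carrier_mat N N" and "i < N" "j < N"
  shows "\<bar>(A ^\<^sub>m l) $$ (i, j)\<bar> \<le> (\<Sum>i<N. \<Sum>j<N. \<bar>A $$ (i, j)\<bar>) ^ l"
  using assms(2,3)
proof (induction l arbitrary: i j)
  case 0
  then show ?case using A by auto
next
  case (Suc l)
  let ?s = "\<Sum>i<N. \<Sum>j<N. \<bar>A $$ (i, j)\<bar>"
  have s: "0 \<le> ?s" by (intro sum_nonneg) auto
  have "\<bar>(A ^\<^sub>m Suc l) $$ (i, j)\<bar> \<le> (\<Sum>r<N. \<bar>A $$ (i, r)\<bar> * \<bar>(A ^\<^sub>m l) $$ (r, j)\<bar>)"
    unfolding pow_mat_Suc_entry[OF A Suc.prems] by (rule order_trans[OF sum_abs]) (simp add: abs_mult)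
  also have "\<dots> \<le> (\<Sum>r<N. \<bar>A $$ (i, r)\<bar> * ?s ^ l)"
    using Suc by (intro sum_mono mult_left_mono) auto
  also have "\<dots> = (\<Sum>r<N. \<bar>A $$ (i, r)\<bar>) * ?s ^ l"
    by (simp add: sum_distrib_right)
  also have "\<dots> \<le> ?s * ?s ^ l"
    using Suc.prems s
    by (intro mult_right_mono member_le_sum[where f = "\<lambda>i. \<Sum>r<N. \<bar>A $$ (i, r)\<bar>"])
      (auto intro: sum_nonneg)
  finally show ?case by simp
qed

text \<open>Dominated by the series of the scalar exponential at \<open>?s * \<bar>t\<bar>\<close>.
  The summand has the shape coefficient times \<open>t ^ l\<close>, so that termwise differentiation
  applies for every real \<open>t\<close>.\<close>

lemma summable_mat_exp_entry:
  fixes A :: "real mat"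
  assumes A: "A \<in> carrier_mat N N" and ij: "i < N" "j < N"
  shows "summable (\<lambda>l. (A ^\<^sub>m l) $$ (i, j) / fact l * t ^ l)"
proof (rule summable_comparison_test')
  let ?s = "\<Sum>i<N. \<Sum>j<N. \<bar>A $$ (i, j)\<bar>"
  show "summable (\<lambda>l. inverse (fact l) * (?s * \<bar>t\<bar>) ^ l)"
    by (rule summable_exp)
  show "norm ((A ^\<^sub>m l) $$ (i, j) / fact l * t ^ l) \<le> inverse (fact l) * (?s * \<bar>t\<bar>) ^ l" for l
    using mult_right_mono[OF abs_pow_mat_entry_le[OF A ij, of l], of "\<bar>t\<bar> ^ l / fact l"]
    by (simp add: abs_mult power_mult_distrib power_abs field_simps)
qed

lemma mat_exp_carrier: "A \<in> carrier_mat N N \<Longrightarrow> mat_exp A \<in> carrier_mat N N"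
  by (auto simp: mat_exp_def)

lemma mat_exp_smult_entry:
  fixes A :: "real mat"
  assumes A: "A \<in> carrier_mat N N" and ij: "i < N" "j < N"
  shows "mat_exp (t \<cdot>\<^sub>m A) $$ (i, j) = (\<Sum>l. (A ^\<^sub>m l) $$ (i, j) / fact l * t ^ l)"
proof -
  have "(t ^ l \<cdot>\<^sub>m (A ^\<^sub>m l)) $$ (i, j) = t ^ l * (A ^\<^sub>m l) $$ (i, j)" for l
    using carrier_matD[OF pow_carrier_mat[OF A, of l]] ij by simp
  then show ?thesis
    using A ij by (auto simp: mat_exp_def smult_pow_mat[OF A] mult.commute)
qed

lemma mat_exp_transpose:
  fixes A :: "real mat"
  assumes A: "A \<in> carrier_mat N N"
  shows "mat_exp (t \<cdot>\<^sub>m transpose_mat A) = transpose_mat (mat_exp (t \<cdot>\<^sub>m A))"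
proof (rule eq_matI)
  have tA: "t \<cdot>\<^sub>m A \<in> carrier_mat N N" and tAT: "t \<cdot>\<^sub>m transpose_mat A \<in> carrier_mat N N"
    using A by auto
  note c = mat_exp_carrier[OF tA] mat_exp_carrier[OF tAT]
  show "dim_row (mat_exp (t \<cdot>\<^sub>m transpose_mat A)) = dim_row (transpose_mat (mat_exp (t \<cdot>\<^sub>m A)))"
    and "dim_col (mat_exp (t \<cdot>\<^sub>m transpose_mat A)) = dim_col (transpose_mat (mat_exp (t \<cdot>\<^sub>m A)))"
    using c by auto
  fix i j
  assume "i < dim_row (transpose_mat (mat_exp (t \<cdot>\<^sub>m A)))"
    and "j < dim_col (transpose_mat (mat_exp (t \<cdot>\<^sub>m A)))"
  then have ij: "i < N" "j < N" using c by auto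
  have "(transpose_mat A ^\<^sub>m l) $$ (i, j) = (A ^\<^sub>m l) $$ (j, i)" for l
    using transpose_pow_mat[OF A, of l] carrier_matD[OF pow_carrier_mat[OF A, of l]] ij by simp
  then show "mat_exp (t \<cdot>\<^sub>m transpose_mat A) $$ (i, j) = transpose_mat (mat_exp (t \<cdot>\<^sub>m A)) $$ (i, j)"
    using c ij A by (simp add: mat_exp_smult_entry[of _ N])
qed

lemma mat_exp_zero:
  fixes A :: "real mat"
  assumes A: "A \<in> carrier_mat N N"
  shows "mat_exp (0 \<cdot>\<^sub>m A) = 1\<^sub>m N"
proof (rule eq_matI)
  have "0 \<cdot>\<^sub>m A \<in> carrier_mat N N" using A by auto
  note c = mat_exp_carrier[OF this]
  show "dim_row (mat_exp (0 \<cdot>\<^sub>m A)) = dim_row (1\<^sub>m N :: real mat)"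
    and "dim_col (mat_exp (0 \<cdot>\<^sub>m A)) = dim_col (1\<^sub>m N :: real mat)"
    using c by auto
  fix i j assume "i < dim_row (1\<^sub>m N :: real mat)" "j < dim_col (1\<^sub>m N :: real mat)"
  then show "mat_exp (0 \<cdot>\<^sub>m A) $$ (i, j) = (1\<^sub>m N :: real mat) $$ (i, j)"
    using A by (simp add: mat_exp_smult_entry[OF A] powser_zero del: times_divide_eq_left)
qed

lemma mat_exp_entry_has_derivative:
  fixes A :: "real mat"
  assumes A: "A \<in> carrier_mat N N" and ij: "i < N" "j < N"
  shows "((\<lambda>t. mat_exp (t \<cdot>\<^sub>m A) $$ (i, j)) has_real_derivative
      (\<Sum>r<N. A $$ (i, r) * mat_exp (t \<cdot>\<^sub>m A) $$ (r, j))) (at t)"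
proof -
  let ?c = "\<lambda>r l. (A ^\<^sub>m l) $$ (r, j) / fact l"
  have "((\<lambda>t. \<Sum>l. ?c i l * t ^ l) has_real_derivative (\<Sum>l. diffs (?c i) l * t ^ l)) (at t)"
    by (rule termdiffs_strong_converges_everywhere[OF summable_mat_exp_entry[OF A ij]])
  \<comment> \<open>\<open>diffs\<close> shifts the coefficients:
    \<open>(l + 1) / fact (l + 1)\<close> becomes \<open>1 / fact l\<close>, which leaves the power
    \<open>Suc l\<close>, whose left factor \<open>A\<close> is then split off.\<close>
  moreover have "diffs (?c i) l * t ^ l = (\<Sum>r<N. A $$ (i, r) * (?c r l * t ^ l))" for l
  proof -
    have "diffs (?c i) l = (A ^\<^sub>m Suc l) $$ (i, j) / fact l"
      by (simp add: diffs_def del: pow_mat.simps)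
    then show ?thesis
      by (simp add: pow_mat_Suc_entry[OF A ij] sum_distrib_right sum_divide_distrib mult.assoc
          del: pow_mat.simps)
  qed
  moreover have "(\<Sum>l. \<Sum>r<N. A $$ (i, r) * (?c r l * t ^ l))
      = (\<Sum>r<N. A $$ (i, r) * (\<Sum>l. ?c r l * t ^ l))"
  proof (subst suminf_sum)
    show "summable (\<lambda>l. A $$ (i, r) * (?c r l * t ^ l))" if "r \<in> {..<N}" for r
      using that by (intro summable_mult summable_mat_exp_entry[OF A _ ij(2)]) simp
    show "(\<Sum>r<N. \<Sum>l. A $$ (i, r) * (?c r l * t ^ l)) = (\<Sum>r<N. A $$ (i, r) * (\<Sum>l. ?c r l * t ^ l))"
      by (intro sum.cong refl suminf_mult summable_mat_exp_entry[OF A _ ij(2)]) simp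
  qed
  ultimately show ?thesis
    using ij by (simp add: mat_exp_smult_entry[OF A])
qed

section \<open>Derivatives along trajectories of the unforced system\<close>

lemma mult_mat_vec_index_sum:
  fixes A :: "real mat"
  assumes "A \<in> carrier_mat M N" "u \<in> carrier_vec N" "i < M"
  shows "vec_index (A *\<^sub>v u) i = (\<Sum>j<N. A $$ (i, j) * vec_index u j)"
  using assms by (auto simp: scalar_prod_def atLeast0LessThan intro!: sum.cong)

lemma mat_exp_mult_vec_has_derivative:
  fixes A :: "real mat"
  assumes A: "A \<in> carrier_mat N N" and u: "u \<in> carrier_vec N" and i: "i < N"
  shows "((\<lambda>t. vec_index (mat_exp (t \<cdot>\<^sub>m A) *\<^sub>v u) i) has_real_derivative
      vec_index (A *\<^sub>v (mat_exp (t \<cdot>\<^sub>m A) *\<^sub>v u)) i) (at t)"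
proof -
  have c: "mat_exp (t \<cdot>\<^sub>m A) \<in> carrier_mat N N" for t
    using A by (intro mat_exp_carrier) auto
  have "((\<lambda>t. \<Sum>j<N. mat_exp (t \<cdot>\<^sub>m A) $$ (i, j) * vec_index u j) has_real_derivative
      (\<Sum>j<N. (\<Sum>r<N. A $$ (i, r) * mat_exp (t \<cdot>\<^sub>m A) $$ (r, j)) * vec_index u j)) (at t)"
    using mat_exp_entry_has_derivative[OF A i]
    by (intro DERIV_sum DERIV_cmult_right) auto
  moreover have "(\<Sum>j<N. (\<Sum>r<N. A $$ (i, r) * mat_exp (t \<cdot>\<^sub>m A) $$ (r, j)) * vec_index u j)
      = vec_index (A *\<^sub>v (mat_exp (t \<cdot>\<^sub>m A) *\<^sub>v u)) i"
    using mult_mat_vec_carrier[OF c u] u i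
    by (subst mult_mat_vec_index_sum[OF A _ i])
      (auto simp: mult_mat_vec_index_sum[OF c u] sum_distrib_left sum_distrib_right mult.assoc
        intro: sum.swap)
  ultimately show ?thesis
    by (simp only: mult_mat_vec_index_sum[OF c u i])
qed

text \<open>The product rule, coordinate by coordinate. Symmetry of \<open>X\<close> is not assumed,
  so the two terms stay separate. The vector \<open>y\<close> is the velocity at the single time
  \<open>t\<close>.\<close>

lemma quadratic_form_has_derivative:
  fixes X :: "real mat" and x :: "real \<Rightarrow> real Matrix.vec"
  assumes X: "X \<in> carrier_mat N N" and x: "\<And>t. x t \<in> carrier_vec N" and y: "y \<in> carrier_vec N"
    and d: "\<And>i. i < N \<Longrightarrow> ((\<lambda>t. vec_index (x t) i) has_real_derivative vec_index y i) (at t)"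
  shows "((\<lambda>t. scalar_prod (x t) (X *\<^sub>v x t)) has_real_derivative
      scalar_prod y (X *\<^sub>v x t) + scalar_prod (x t) (X *\<^sub>v y)) (at t)"
proof -
  have q: "scalar_prod u (X *\<^sub>v v) = (\<Sum>i<N. vec_index u i * (\<Sum>j<N. X $$ (i, j) * vec_index v j))"
    if "u \<in> carrier_vec N" "v \<in> carrier_vec N" for u v
    using that X by (auto simp: scalar_prod_def atLeast0LessThan intro!: sum.cong)
  have "((\<lambda>t. \<Sum>i<N. vec_index (x t) i * (\<Sum>j<N. X $$ (i, j) * vec_index (x t) j))
      has_real_derivative
      (\<Sum>i<N. vec_index y i * (\<Sum>j<N. X $$ (i, j) * vec_index (x t) j) +
         (\<Sum>j<N. X $$ (i, j) * vec_index y j) * vec_index (x t) i)) (at t)"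
    by (intro DERIV_sum DERIV_mult DERIV_cmult d) auto
  then show ?thesis
    by (simp add: q x y sum.distrib mult.commute)
qed

section \<open>From the trace formula for the H2 norm to a Lyapunov bound\<close>

lemma mat_trace_congruence:
  fixes X :: "real mat"
  assumes X: "X \<in> carrier_mat N N" and Y: "Y \<in> carrier_mat N r"
  shows "mat_trace (transpose_mat Y * X * Y) = (\<Sum>j<r. scalar_prod (col Y j) (X *\<^sub>v col Y j))"
proof -
  have "transpose_mat Y * X * Y = transpose_mat Y * (X * Y)"
    using X Y by (intro assoc_mult_mat[of _ r N _ N _ r]) auto
  then show ?thesis
    using X Y unfolding mat_trace_def by (auto intro!: sum.cong)
qed

text \<open>The matrix under the trace is \<open>Y\<^sup>T Y\<close> with
  \<open>Y = C exp (t A) B\<close>, and column \<open>j\<close> of \<open>Y\<close> is the output at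
  time \<open>t\<close> of the trajectory starting at column \<open>j\<close> of \<open>B\<close>.
  The H2 integrand thus becomes the output energy of the impulse responses.\<close>

lemma mat_trace_impulse_response:
  fixes A B C :: "real mat"
  assumes A: "A \<in> carrier_mat N N" and B: "B \<in> carrier_mat N r" and C: "C \<in> carrier_mat q N"
  shows "mat_trace (transpose_mat B * mat_exp (t \<cdot>\<^sub>m transpose_mat A) * transpose_mat C *
        C * mat_exp (t \<cdot>\<^sub>m A) * B) =
     (\<Sum>j<r. scalar_prod (C *\<^sub>v (mat_exp (t \<cdot>\<^sub>m A) *\<^sub>v col B j)) (C *\<^sub>v (mat_exp (t \<cdot>\<^sub>m A) *\<^sub>v col B j)))"
proof -
  define P where "P = mat_exp (t \<cdot>\<^sub>m A)"
  have P: "P \<in> carrier_mat N N"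
    unfolding P_def using A by (intro mat_exp_carrier) auto
  have PB: "P * B \<in> carrier_mat N r" and Y: "C * (P * B) \<in> carrier_mat q r"
    using P B C by auto
  have YT: "transpose_mat B * transpose_mat P * transpose_mat C = transpose_mat (C * (P * B))"
    using transpose_mult[OF C PB] transpose_mult[OF P B] by simp
  have "transpose_mat (C * (P * B)) * C * P * B = transpose_mat (C * (P * B)) * C * (P * B)"
    using P B C Y by (intro assoc_mult_mat[of _ r N _ N _ r]) auto
  also have "\<dots> = transpose_mat (C * (P * B)) * (C * (P * B))"
    using PB C Y by (intro assoc_mult_mat[of _ r q _ N _ r]) auto
  \<comment> \<open>The identity is inserted so that \<open>mat_trace_congruence\<close> applies
    with \<open>X\<close> the identity.\<close>
  also have "\<dots> = transpose_mat (C * (P * B)) * 1\<^sub>m q * (C * (P * B))"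
    using right_mult_one_mat[of "transpose_mat (C * (P * B))" r q] Y by simp
  finally have "mat_trace (transpose_mat B * transpose_mat P * transpose_mat C * C * P * B) =
      (\<Sum>j<r. scalar_prod (col (C * (P * B)) j) (1\<^sub>m q *\<^sub>v col (C * (P * B)) j))"
    unfolding YT using mat_trace_congruence[OF one_carrier_mat Y] by simp
  also have "\<dots> = (\<Sum>j<r. scalar_prod (C *\<^sub>v (P *\<^sub>v col B j)) (C *\<^sub>v (P *\<^sub>v col B j)))"
  proof (intro sum.cong refl)
    fix j assume "j \<in> {..<r}"
    then have "col (C * (P * B)) j = C *\<^sub>v (P *\<^sub>v col B j)"
      using col_mult2[OF C PB] col_mult2[OF P B] by simp
    moreover have "C *\<^sub>v (P *\<^sub>v col B j) \<in> carrier_vec q" using C P B by auto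
    ultimately show "scalar_prod (col (C * (P * B)) j) (1\<^sub>m q *\<^sub>v col (C * (P * B)) j)
        = scalar_prod (C *\<^sub>v (P *\<^sub>v col B j)) (C *\<^sub>v (P *\<^sub>v col B j))"
      by simp
  qed
  finally show ?thesis
    unfolding mat_exp_transpose[OF A] P_def .
qed

text \<open>On a bounded interval the integral is at most \<open>V 0 - V N\<close>, hence at most
  \<open>V 0\<close>, uniformly in \<open>N\<close>; monotone convergence extends this to the
  half-line. Nonnegativity of \<open>V\<close> at the right endpoint takes the place of any decay of
  \<open>V\<close> at infinity.\<close>

lemma nn_integral_atLeast_le:
  fixes f V V' :: "real \<Rightarrow> real"
  assumes f: "f \<in> borel_measurable borel" and V': "V' \<in> borel_measurable borel"
    and f0: "\<And>t. 0 \<le> f t" and le: "\<And>t. f t \<le> - V' t"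
    and V: "\<And>t. (V has_real_derivative V' t) (at t)" and V0: "\<And>t. 0 \<le> V t"
  shows "(\<integral>\<^sup>+ t. ennreal (f t) * indicator {0..} t \<partial>lborel) \<le> ennreal (V 0)"
proof -
  let ?g = "\<lambda>N t. ennreal (f t) * indicator {0..real N} t"
  have SUP: "(SUP N. ?g N t) = ennreal (f t) * indicator {0..} t" for t
  proof (intro antisym SUP_least)
    show "?g N t \<le> ennreal (f t) * indicator {0..} t" for N
      by (auto split: split_indicator)
    obtain N where "t \<le> real N" using real_arch_simple by blast
    then show "ennreal (f t) * indicator {0..} t \<le> (SUP N. ?g N t)"
      by (intro SUP_upper2[of N]) (auto split: split_indicator)
  qed
  have "(\<integral>\<^sup>+ t. ennreal (f t) * indicator {0..} t \<partial>lborel) = (\<integral>\<^sup>+ t. (SUP N. ?g N t) \<partial>lborel)"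
    by (simp add: SUP)
  also have "\<dots> = (SUP N. \<integral>\<^sup>+ t. ?g N t \<partial>lborel)"
    using f by (intro nn_integral_monotone_convergence_SUP)
      (auto simp: incseq_def le_fun_def split: split_indicator)
  also have "\<dots> \<le> ennreal (V 0)"
  proof (rule SUP_least)
    fix N :: nat
    have "(\<integral>\<^sup>+ t. ?g N t \<partial>lborel)
        \<le> (\<integral>\<^sup>+ t. ennreal (- V' t) * indicator {0..real N} t \<partial>lborel)"
      using le by (intro nn_integral_mono mult_right_mono ennreal_leI) auto
    \<comment> \<open>The fundamental theorem for nonnegative integrands is applied to
      \<open>- V\<close>, whose derivative is nonnegative because it dominates
      \<open>f\<close>.\<close>
    also have "\<dots> = ennreal ((- V (real N)) - (- V 0))"
    proof (rule nn_integral_FTC_Icc)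
      show "(\<lambda>t. - V' t) \<in> borel_measurable borel" using V' by simp
      show "((\<lambda>t. - V t) has_real_derivative - V' t) (at t)" for t
        by (intro DERIV_minus V)
      show "0 \<le> - V' t" for t using f0 le order_trans by blast
    qed auto
    also have "\<dots> \<le> ennreal (V 0)"
      using V0 by (intro ennreal_leI) simp
    finally show "(\<integral>\<^sup>+ t. ?g N t \<partial>lborel) \<le> ennreal (V 0)" .
  qed
  finally show ?thesis .
qed

text \<open>The dissipation hypothesis is the Lyapunov inequality
  \<open>A\<^sup>T X + X A + C\<^sup>T C \<le> 0\<close>, read as a quadratic form. Replacing the
  Gramian equation by an inequality turns the trace formula into an upper bound, obtained by
  integrating the decrease of the stored energy along each impulse response.\<close>

lemma h2_norm_sq_le_lyapunov:
  fixes A B C X :: "real mat"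
  assumes A: "A \<in> carrier_mat N N" and B: "B \<in> carrier_mat N r" and C: "C \<in> carrier_mat q N"
    and X: "X \<in> carrier_mat N N"
    and nonneg: "\<And>x. x \<in> carrier_vec N \<Longrightarrow> 0 \<le> scalar_prod x (X *\<^sub>v x)"
    and dissip: "\<And>x. x \<in> carrier_vec N \<Longrightarrow>
      scalar_prod (A *\<^sub>v x) (X *\<^sub>v x) + scalar_prod x (X *\<^sub>v (A *\<^sub>v x))
        + scalar_prod (C *\<^sub>v x) (C *\<^sub>v x) \<le> 0"
  shows "h2_norm_sq A B C \<le> ennreal (mat_trace (transpose_mat B * X * B))"
proof -
  define x where "x j t = mat_exp (t \<cdot>\<^sub>m A) *\<^sub>v col B j" for j t
  have x: "x j t \<in> carrier_vec N" for j t
    unfolding x_def using A B by (intro mult_mat_vec_carrier[OF mat_exp_carrier]) auto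
  have Ax: "A *\<^sub>v x j t \<in> carrier_vec N" for j t using A x by auto
  have dx: "((\<lambda>t. vec_index (x j t) i) has_real_derivative vec_index (A *\<^sub>v x j t) i) (at t)"
    if "i < N" for i j t
    unfolding x_def using that A B by (intro mat_exp_mult_vec_has_derivative) auto
  have cont: "continuous_on UNIV (\<lambda>t. vec_index (x j t) i)" if "i < N" for i j
    using dx[OF that] by (intro DERIV_continuous_on) auto
  \<comment> \<open>Two independent matrices \<open>P\<close> and \<open>Q\<close> let one fact give
    measurability of both the output energy and the terms of \<open>V'\<close>.\<close>
  have cont_quad: "continuous_on UNIV (\<lambda>t. scalar_prod (P *\<^sub>v x j t) (Q *\<^sub>v x j t))"
    if P: "P \<in> carrier_mat s N" and Q: "Q \<in> carrier_mat s N" for P Q :: "real mat" and s j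
  proof -
    have "scalar_prod (P *\<^sub>v x j t) (Q *\<^sub>v x j t) = (\<Sum>i<s. (\<Sum>l<N. P $$ (i, l) * vec_index (x j t) l)
        * (\<Sum>l<N. Q $$ (i, l) * vec_index (x j t) l))" for t
      using P Q x[of j t]
      by (auto simp: scalar_prod_def atLeast0LessThan intro!: sum.cong arg_cong2[where f = "(*)"])
    then show ?thesis
      by (auto intro!: continuous_intros cont)
  qed
  define f where "f t = (\<Sum>j<r. scalar_prod (C *\<^sub>v x j t) (C *\<^sub>v x j t))" for t
  define V where "V t = (\<Sum>j<r. scalar_prod (x j t) (X *\<^sub>v x j t))" for t
  define V' where "V' t = (\<Sum>j<r. scalar_prod (A *\<^sub>v x j t) (X *\<^sub>v x j t)
      + scalar_prod (x j t) (X *\<^sub>v (A *\<^sub>v x j t)))" for t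
  have "h2_norm_sq A B C = (\<integral>\<^sup>+ t. ennreal (f t) * indicator {0..} t \<partial>lborel)"
    unfolding h2_norm_sq_def f_def x_def mat_trace_impulse_response[OF A B C] ..
  also have "\<dots> \<le> ennreal (V 0)"
  proof (rule nn_integral_atLeast_le)
    show "f \<in> borel_measurable borel"
      unfolding f_def using C
      by (intro borel_measurable_continuous_onI continuous_intros cont_quad)
    \<comment> \<open>This brings the second term of \<open>V'\<close> into the form of
      \<open>cont_quad\<close>, with the identity and \<open>X * A\<close>.\<close>
    have "scalar_prod (x j t) (X *\<^sub>v (A *\<^sub>v x j t))
        = scalar_prod (1\<^sub>m N *\<^sub>v x j t) ((X * A) *\<^sub>v x j t)" for j t
      using x A X by (simp add: assoc_mult_mat_vec[OF X A x])
    then show "V' \<in> borel_measurable borel"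
      unfolding V'_def using A X
      by (auto intro!: borel_measurable_continuous_onI continuous_intros cont_quad)
    show "0 \<le> f t" for t
      unfolding f_def by (auto simp: scalar_prod_def intro!: sum_nonneg)
    show "f t \<le> - V' t" for t
    proof -
      have "V' t + f t \<le> 0"
        unfolding f_def V'_def sum.distrib[symmetric] by (intro sum_nonpos dissip x)
      then show ?thesis by simp
    qed
    show "(V has_real_derivative V' t) (at t)" for t
      unfolding V_def V'_def
      by (intro DERIV_sum quadratic_form_has_derivative[OF X x Ax] dx)
    show "0 \<le> V t" for t
      unfolding V_def by (intro sum_nonneg nonneg x)
  qed
  also have "V 0 = mat_trace (transpose_mat B * X * B)"
  proof -
    have "x j 0 = col B j" for j
      unfolding x_def mat_exp_zero[OF A] using B by (intro one_mult_mat_vec) auto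
    then show ?thesis unfolding V_def mat_trace_congruence[OF X B] by simp
  qed
  finally show ?thesis .
qed

section \<open>The closed loop and its storage function\<close>

lemma sys_A_carrier:
  "sys_A n p E Ec m d k \<tau> \<tau>\<nu> \<alpha> \<in> carrier_mat (p + n + (n + p)) (p + n + (n + p))"
  if "E \<in> carrier_mat n p" "Ec \<in> carrier_mat n p"
  using that by (auto simp: sys_A_def)

lemma sys_B_carrier: "sys_B n p m b \<tau> \<in> carrier_mat (p + n + (n + p)) n"
  unfolding sys_B_def by (intro carrier_append_rows) auto

lemma sys_C_carrier: "sys_C n p k \<in> carrier_mat n (p + n + (n + p))"
  by (auto simp: sys_C_def append_rows_def)

lemma scalar_prod_append4:
  fixes a b c e :: "real Matrix.vec"
  assumes "\<phi> \<in> carrier_vec p" "\<omega> \<in> carrier_vec n" "\<mu> \<in> carrier_vec n" "\<nu> \<in> carrier_vec p"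
    "a \<in> carrier_vec p" "b \<in> carrier_vec n" "c \<in> carrier_vec n" "e \<in> carrier_vec p"
  shows "scalar_prod ((\<phi> @\<^sub>v \<omega>) @\<^sub>v (\<mu> @\<^sub>v \<nu>)) ((a @\<^sub>v b) @\<^sub>v (c @\<^sub>v e)) =
     scalar_prod \<phi> a + scalar_prod \<omega> b + (scalar_prod \<mu> c + scalar_prod \<nu> e)"
  using assms by (simp add: scalar_prod_append[of _ "p + n" _ "n + p"] scalar_prod_append[of _ p _ n]
      scalar_prod_append[of _ n _ p])

text \<open>The factors \<open>1 / 2\<close> offset the two equal terms in the derivative of the
  quadratic form, so that the output energy appears with coefficient one. The zero blocks are
  spelled out so that \<open>four_block_mult_vec4\<close> handles this matrix just as it handles
  \<open>sys_A\<close>.\<close>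

definition storage_mat :: "nat \<Rightarrow> nat \<Rightarrow> real \<Rightarrow> real \<Rightarrow> real \<Rightarrow> real \<Rightarrow> real mat" where
  "storage_mat n p m \<tau> \<tau>\<nu> \<alpha> = four_block_mat
     (four_block_mat ((\<alpha> / 2) \<cdot>\<^sub>m 1\<^sub>m p) (0\<^sub>m p n) (0\<^sub>m n p) ((\<alpha> * m / 2) \<cdot>\<^sub>m 1\<^sub>m n))
     (four_block_mat (0\<^sub>m p n) (0\<^sub>m p p) (0\<^sub>m n n) (0\<^sub>m n p))
     (four_block_mat (0\<^sub>m n p) (0\<^sub>m n n) (0\<^sub>m p p) (0\<^sub>m p n))
     (four_block_mat ((\<tau> / 2) \<cdot>\<^sub>m 1\<^sub>m n) (0\<^sub>m n p) (0\<^sub>m p n) ((\<tau>\<nu> / 2) \<cdot>\<^sub>m 1\<^sub>m p))"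

lemma storage_mat_mult_vec:
  assumes v: "\<phi> \<in> carrier_vec p" "\<omega> \<in> carrier_vec n" "\<mu> \<in> carrier_vec n" "\<nu> \<in> carrier_vec p"
  shows "storage_mat n p m \<tau> \<tau>\<nu> \<alpha> *\<^sub>v ((\<phi> @\<^sub>v \<omega>) @\<^sub>v (\<mu> @\<^sub>v \<nu>)) =
     ((\<alpha> / 2) \<cdot>\<^sub>v \<phi> @\<^sub>v (\<alpha> * m / 2) \<cdot>\<^sub>v \<omega>) @\<^sub>v ((\<tau> / 2) \<cdot>\<^sub>v \<mu> @\<^sub>v (\<tau>\<nu> / 2) \<cdot>\<^sub>v \<nu>)"
proof -
  have dims: "dim_vec \<phi> = p" "dim_vec \<omega> = n" "dim_vec \<mu> = n" "dim_vec \<nu> = p"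
    using v by auto
  show ?thesis
    unfolding storage_mat_def
    by (subst four_block_mult_vec4[where p = p and n = n])
      (use v dims in \<open>auto simp: smult_mat_mult_vec zero_mat_mult_vec append_vec_def Let_def intro!: eq_vecI\<close>)
qed

lemma storage_mat_carrier: "storage_mat n p m \<tau> \<tau>\<nu> \<alpha> \<in> carrier_mat (p + n + (n + p)) (p + n + (n + p))"
  by (auto simp: storage_mat_def)

lemma carrier_vec4_cases:
  assumes "x \<in> carrier_vec (p + n + (n + p))"
  obtains \<phi> \<omega> \<mu> \<nu> where "\<phi> \<in> carrier_vec p" "\<omega> \<in> carrier_vec n" "\<mu> \<in> carrier_vec n" "\<nu> \<in> carrier_vec p"
    and "x = (\<phi> @\<^sub>v \<omega>) @\<^sub>v (\<mu> @\<^sub>v \<nu>)"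
proof
  let ?u = "vec_first x (p + n)" and ?v = "vec_last x (n + p)"
  have "x = ?u @\<^sub>v ?v" using assms by simp
  moreover have "?u = vec_first ?u p @\<^sub>v vec_last ?u n" "?v = vec_first ?v n @\<^sub>v vec_last ?v p" by simp_all
  ultimately show "x = (vec_first ?u p @\<^sub>v vec_last ?u n) @\<^sub>v (vec_first ?v n @\<^sub>v vec_last ?v p)"
    by simp
qed auto

lemma sys_A_mult_vec:
  assumes E: "E \<in> carrier_mat n p" "Ec \<in> carrier_mat n p"
    and v: "\<phi> \<in> carrier_vec p" "\<omega> \<in> carrier_vec n" "\<mu> \<in> carrier_vec n" "\<nu> \<in> carrier_vec p"
  shows "sys_A n p E Ec m d k \<tau> \<tau>\<nu> \<alpha> *\<^sub>v ((\<phi> @\<^sub>v \<omega>) @\<^sub>v (\<mu> @\<^sub>v \<nu>)) =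
    (transpose_mat E *\<^sub>v \<omega> @\<^sub>v (1 / m) \<cdot>\<^sub>v (- (E *\<^sub>v \<phi>) - d \<cdot>\<^sub>v \<omega> - (1 / k) \<cdot>\<^sub>v \<mu>)) @\<^sub>v
    ((1 / \<tau>) \<cdot>\<^sub>v ((\<alpha> / k) \<cdot>\<^sub>v \<omega> - (1 / k) \<cdot>\<^sub>v \<mu> - Ec *\<^sub>v \<nu>) @\<^sub>v
     (1 / \<tau>\<nu>) \<cdot>\<^sub>v (transpose_mat Ec *\<^sub>v \<mu>))" (is "?A *\<^sub>v ?x = ?y")
proof -
  \<comment> \<open>The autonomous equations are read off \<open>sys_state_equation\<close> with
    zero input and \<open>b = 0\<close>, rather than by multiplying out the blocks again.\<close>
  have "sys_B n p m 0 \<tau> *\<^sub>v 0\<^sub>v n = 0\<^sub>v (p + n + (n + p))"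
    by (intro eq_vecI) (auto simp: sys_B_def append_rows_def scalar_prod_def)
  moreover have "?A *\<^sub>v ?x \<in> carrier_vec (p + n + (n + p))"
    by (intro mult_mat_vec_carrier[OF sys_A_carrier[OF E]] append_carrier_vec v)
  ultimately have "?A *\<^sub>v ?x = ?A *\<^sub>v ?x + sys_B n p m 0 \<tau> *\<^sub>v 0\<^sub>v n" by simp
  also have "\<dots> = ?y"
  proof -
    have "- (E *\<^sub>v \<phi>) - d \<cdot>\<^sub>v \<omega> - (1 / k) \<cdot>\<^sub>v \<mu> \<in> carrier_vec n"
      and "(\<alpha> / k) \<cdot>\<^sub>v \<omega> - (1 / k) \<cdot>\<^sub>v \<mu> - Ec *\<^sub>v \<nu> \<in> carrier_vec n"
      using E v by auto
    moreover have "0 \<cdot>\<^sub>v 0\<^sub>v n = (0\<^sub>v n :: real Matrix.vec)"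
      by (intro eq_vecI) auto
    ultimately show ?thesis
      unfolding sys_state_equation[OF E v zero_carrier_vec] by simp
  qed
  finally show ?thesis .
qed

lemma sys_B_mult_vec:
  assumes "\<eta> \<in> carrier_vec n"
  shows "sys_B n p m b \<tau> *\<^sub>v \<eta> = (0\<^sub>v p @\<^sub>v (b / m) \<cdot>\<^sub>v \<eta>) @\<^sub>v ((b / \<tau>) \<cdot>\<^sub>v \<eta> @\<^sub>v 0\<^sub>v p)"
  unfolding sys_B_def using assms
  by (simp add: mat_mult_append[where nc = n and ?nr1.0 = "p + n" and ?nr2.0 = "n + p"]
      mat_mult_append[where nc = n and ?nr1.0 = p and ?nr2.0 = n]
      mat_mult_append[where nc = n and ?nr1.0 = n and ?nr2.0 = p]
      carrier_append_rows zero_mat_mult_vec smult_mat_mult_vec)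

text \<open>An exact balance: the damping \<open>- \<mu>\<^sup>T \<mu> / k\<close> of the multiplier
  equation is precisely minus the output energy, so only the friction term weighted by \<alpha>
  remains.\<close>

lemma storage_mat_dissipation:
  assumes E: "E \<in> carrier_mat n p" and Ec: "Ec \<in> carrier_mat n p"
    and v: "\<phi> \<in> carrier_vec p" "\<omega> \<in> carrier_vec n" "\<mu> \<in> carrier_vec n" "\<nu> \<in> carrier_vec p"
    and pos: "m > 0" "d > 0" "k > 0" "\<tau> > 0" "\<tau>\<nu> > 0" "\<alpha> \<ge> 0"
  defines "A \<equiv> sys_A n p E Ec m d k \<tau> \<tau>\<nu> \<alpha>" and "X \<equiv> storage_mat n p m \<tau> \<tau>\<nu> \<alpha>"
    and "C \<equiv> sys_C n p k" and "x \<equiv> (\<phi> @\<^sub>v \<omega>) @\<^sub>v (\<mu> @\<^sub>v \<nu>)"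
  shows "scalar_prod (A *\<^sub>v x) (X *\<^sub>v x) + scalar_prod x (X *\<^sub>v (A *\<^sub>v x))
      + scalar_prod (C *\<^sub>v x) (C *\<^sub>v x) = - \<alpha> * d * scalar_prod \<omega> \<omega>"
proof -
  let ?dw = "(1 / m) \<cdot>\<^sub>v (- (E *\<^sub>v \<phi>) - d \<cdot>\<^sub>v \<omega> - (1 / k) \<cdot>\<^sub>v \<mu>)"
  let ?dmu = "(1 / \<tau>) \<cdot>\<^sub>v ((\<alpha> / k) \<cdot>\<^sub>v \<omega> - (1 / k) \<cdot>\<^sub>v \<mu> - Ec *\<^sub>v \<nu>)"
  let ?dphi = "transpose_mat E *\<^sub>v \<omega>" and ?dnu = "(1 / \<tau>\<nu>) \<cdot>\<^sub>v (transpose_mat Ec *\<^sub>v \<mu>)"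
  have car: "?dphi \<in> carrier_vec p" "?dw \<in> carrier_vec n" "?dmu \<in> carrier_vec n" "?dnu \<in> carrier_vec p"
    "E *\<^sub>v \<phi> \<in> carrier_vec n" "Ec *\<^sub>v \<nu> \<in> carrier_vec n" "transpose_mat Ec *\<^sub>v \<mu> \<in> carrier_vec p"
    using E Ec v by auto
  have Ax: "A *\<^sub>v x = (?dphi @\<^sub>v ?dw) @\<^sub>v (?dmu @\<^sub>v ?dnu)"
    unfolding A_def x_def by (rule sys_A_mult_vec[OF E Ec v])
  \<comment> \<open>Moving \<open>E\<close> to the other side of the product produces the term that
    cancels \<open>- \<omega>\<^sup>T E \<phi>\<close> in \<open>w\<close>; \<open>nu\<close> does
    the same for \<open>Ec\<close> against \<open>mu\<close>.\<close>
  have phi: "scalar_prod \<phi> ?dphi = scalar_prod \<omega> (E *\<^sub>v \<phi>)"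
    using transpose_vec_mult_scalar[OF E v(1,2)] comm_scalar_prod[OF v(1) car(1)] by simp
  have nu: "scalar_prod \<nu> ?dnu = scalar_prod \<mu> (Ec *\<^sub>v \<nu>) / \<tau>\<nu>"
    using transpose_vec_mult_scalar[OF Ec v(4,3)] comm_scalar_prod[OF v(4) car(7)] v car by simp
  have w: "m * scalar_prod \<omega> ?dw =
      - scalar_prod \<omega> (E *\<^sub>v \<phi>) - d * scalar_prod \<omega> \<omega> - scalar_prod \<omega> \<mu> / k"
    using v car pos
    by (simp add: scalar_prod_minus_distrib[of _ n] 
        carrier_vecD[OF v(2)] carrier_vecD[OF car(5)] carrier_matD[OF E])
  \<comment> \<open>The cross term with coefficient \<open>\<alpha> / k\<close> cancels the one in
    \<open>w\<close>, once that is multiplied by \<alpha>.\<close>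
  have mu: "\<tau> * scalar_prod \<mu> ?dmu =
      \<alpha> / k * scalar_prod \<omega> \<mu> - scalar_prod \<mu> \<mu> / k - scalar_prod \<mu> (Ec *\<^sub>v \<nu>)"
    using v car pos
    by (simp add: scalar_prod_minus_distrib[of _ n] comm_scalar_prod[OF v(3) v(2)])
  \<comment> \<open>Since \<open>X\<close> is diagonal, both terms of the derivative
    coincide.\<close>
  have X: "scalar_prod (A *\<^sub>v x) (X *\<^sub>v x) = scalar_prod x (X *\<^sub>v (A *\<^sub>v x))"
    and Xx: "2 * scalar_prod x (X *\<^sub>v (A *\<^sub>v x)) =
      \<alpha> * scalar_prod \<phi> ?dphi + \<alpha> * (m * scalar_prod \<omega> ?dw) + \<tau> * scalar_prod \<mu> ?dmu + \<tau>\<nu> * scalar_prod \<nu> ?dnu"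
    unfolding Ax X_def unfolding x_def storage_mat_mult_vec[OF v] storage_mat_mult_vec[OF car(1-4)]
    using v car(1-4)
      comm_scalar_prod[OF car(1) v(1)] comm_scalar_prod[OF car(2) v(2)]
      comm_scalar_prod[OF car(3) v(3)] comm_scalar_prod[OF car(4) v(4)]
    by (simp_all only: scalar_prod_append4 smult_carrier_vec scalar_prod_smult_distrib)
      (simp_all add: algebra_simps)
  have C: "scalar_prod (C *\<^sub>v x) (C *\<^sub>v x) = scalar_prod \<mu> \<mu> / k"
    unfolding C_def x_def sys_output_equation[OF v] using v pos by simp
  show ?thesis
    using Xx unfolding X C phi nu w mu using pos by (simp add: algebra_simps)
qed

text \<open>The input enters \<omega> with gain \<open>b / m\<close> and \<mu> with gain
  \<open>b / \<tau>\<close>. Each of the \<open>n\<close> columns therefore stores \<open>(\<alpha>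
  m / 2) (b / m)\<^sup>2 + (\<tau> / 2) (b / \<tau>)\<^sup>2\<close>, which gives the two terms of
  the bound.\<close>

lemma storage_mat_trace:
  assumes "m > 0" "\<tau> > 0"
  shows "mat_trace (transpose_mat (sys_B n p m b \<tau>) * storage_mat n p m \<tau> \<tau>\<nu> \<alpha> * sys_B n p m b \<tau>)
    = b\<^sup>2 / (2 * \<tau>) * real n + b\<^sup>2 * \<alpha> * real n / (2 * m)"
proof -
  let ?B = "sys_B n p m b \<tau>" and ?X = "storage_mat n p m \<tau> \<tau>\<nu> \<alpha>"
  note B = sys_B_carrier[of n p m b \<tau>]
  have "scalar_prod (col ?B j) (?X *\<^sub>v col ?B j) = b\<^sup>2 / (2 * \<tau>) + b\<^sup>2 * \<alpha> / (2 * m)" if j: "j < n" for j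
  proof -
    have u: "(b / m) \<cdot>\<^sub>v unit_vec n j \<in> carrier_vec n" "(b / \<tau>) \<cdot>\<^sub>v unit_vec n j \<in> carrier_vec n" by auto
    have "col ?B j = ?B *\<^sub>v unit_vec n j"
      using col_mult2[OF B one_carrier_mat j] B j by simp
    also have "\<dots> = (0\<^sub>v p @\<^sub>v (b / m) \<cdot>\<^sub>v unit_vec n j) @\<^sub>v ((b / \<tau>) \<cdot>\<^sub>v unit_vec n j @\<^sub>v 0\<^sub>v p)"
      by (rule sys_B_mult_vec) simp
    finally show ?thesis
      using j assms u
      by (simp add: storage_mat_mult_vec scalar_prod_append4[of _ p _ n] power2_eq_square field_simps)
  qed
  then show ?thesis
    unfolding mat_trace_congruence[OF storage_mat_carrier B] by (simp add: algebra_simps)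
qed

theorem mainTheorem2:
  fixes n :: nat
    and F Fc :: "nat set set"
    and w wc :: "nat set \<Rightarrow> real"
    and E Ec :: "real mat"
    and \<gamma> m d k b \<tau> \<tau>\<nu> \<alpha> :: real
  assumes "simple_graph n F" and "connected_graph n F" and "acyclic_graph F"
    and "\<And>e. e \<in> F \<Longrightarrow> w e > 0"
    and "E \<in> carrier_mat n (n - 1)" and "weighted_incidence n F w E"
    and "simple_graph n Fc" and "connected_graph n Fc" and "acyclic_graph Fc"
    and "\<And>e. e \<in> Fc \<Longrightarrow> wc e > 0"
    and "Ec \<in> carrier_mat n (n - 1)" and "weighted_incidence n Fc wc Ec"
    and "\<gamma> > 0" and "Ec * transpose_mat Ec = \<gamma> \<cdot>\<^sub>m (E * transpose_mat E)"
    and "m > 0" and "d > 0" and "k > 0" and "b > 0" and "\<tau> > 0" and "\<tau>\<nu> > 0"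
    and "\<alpha> \<ge> 0"
  shows "h2_norm_sq (sys_A n (n - 1) E Ec m d k \<tau> \<tau>\<nu> \<alpha>) (sys_B n (n - 1) m b \<tau>)
           (sys_C n (n - 1) k)
         \<le> ennreal (b\<^sup>2 / (2 * \<tau>) * real n + b\<^sup>2 * \<alpha> * real n / (2 * m))"
proof -
  let ?p = "n - 1"
  let ?N = "?p + n + (n + ?p)"
  let ?A = "sys_A n ?p E Ec m d k \<tau> \<tau>\<nu> \<alpha>" and ?X = "storage_mat n ?p m \<tau> \<tau>\<nu> \<alpha>"
  have "h2_norm_sq ?A (sys_B n ?p m b \<tau>) (sys_C n ?p k)
      \<le> ennreal (mat_trace (transpose_mat (sys_B n ?p m b \<tau>) * ?X * sys_B n ?p m b \<tau>))"
  proof (rule h2_norm_sq_le_lyapunov[OF sys_A_carrier[OF assms(5,11)] sys_B_carrier sys_C_carrier storage_mat_carrier])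
    fix x :: "real Matrix.vec" assume "x \<in> carrier_vec ?N"
    then obtain \<phi> \<omega> \<mu> \<nu> where v: "\<phi> \<in> carrier_vec ?p" "\<omega> \<in> carrier_vec n"
        "\<mu> \<in> carrier_vec n" "\<nu> \<in> carrier_vec ?p" and x: "x = (\<phi> @\<^sub>v \<omega>) @\<^sub>v (\<mu> @\<^sub>v \<nu>)"
      by (rule carrier_vec4_cases)
    have sq: "0 \<le> scalar_prod u u" for u :: "real Matrix.vec"
      by (auto simp: scalar_prod_def intro: sum_nonneg)
    \<comment> \<open>A sum of squares with nonnegative weights; \<open>\<alpha> \<ge> 0\<close>
      serves the weights of \<phi> and \<omega>.\<close>
    show "0 \<le> scalar_prod x (?X *\<^sub>v x)"
      unfolding x storage_mat_mult_vec[OF v] using v assms sq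
      by (simp add: scalar_prod_append4)
    \<comment> \<open>By the balance the left side equals
      \<open>- \<alpha> * d * scalar_prod \<omega> \<omega>\<close>.\<close>
    show "scalar_prod (?A *\<^sub>v x) (?X *\<^sub>v x) + scalar_prod x (?X *\<^sub>v (?A *\<^sub>v x))
        + scalar_prod (sys_C n ?p k *\<^sub>v x) (sys_C n ?p k *\<^sub>v x) \<le> 0"
      unfolding x using assms sq[of \<omega>] by (subst storage_mat_dissipation[OF _ _ v]) auto
  qed
  then show ?thesis
    using assms by (simp add: storage_mat_trace)
qed

end
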